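(* Suppose that $[X]=\varphi_{1,m}(X_{1:m})=[\min_k X_k,\max_k X_k]$, where, conditionally on $(a,b)$, the variables $X_1,\ldots,X_m$ are i.i.d. $U(a,b)$, and $(a,b)$ has global probability density function $\pi(a,b)$ on $\mathbb{R}^2$ which is bounded, continuous and equal to $0$ when $a>b$. Let $$f_{[X]}(\underline{x},\overline{x}\mid m)=\iint_{\{a\le\underline{x},\,b\ge\overline{x}\}} m(m-1)\frac{(\overline{x}-\underline{x})^{m-2}}{(b-a)^m}\,\pi(a,b)\,\mathrm{d}a\,\mathrm{d}b$$ be the resulting density function of $[X]$. Then, as $m\to\infty$, this density converges pointwise to $\pi(\underline{x},\overline{x})$; i.e. for all real $\underline{x}\le\overline{x}$, $$\lim_{m\to\infty}f_{[X]}(\underline{x},\overline{x}\mid m)=\pi(\underline{x},\overline{x}).$$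
   Context: A random interval $[X]=[\underline{X},\overline{X}]$ is a random vector $(\underline{X},\overline{X})$ with $\underline{X}\le\overline{X}$; its density is the joint density of $(\underline{X},\overline{X})$ on $\{(\underline{x},\overline{x})\colon\underline{x}\le\overline{x}\}$. For a vector $x_{1:m}=(x_1,\ldots,x_m)$ of reals, $\varphi_{l,u}(x_{1:m})=[x_{(l)},x_{(u)}]$ is the interval between the $l$-th and $u$-th order statistics. $U(a,b)$ is the uniform distribution on $[a,b]$. The displayed formula for $f_{[X]}(\cdot\mid m)$ (for $m\ge2$) is the mixture over $(a,b)\sim\pi$ of the joint density $m(m-1)(\overline{x}-\underline{x})^{m-2}(b-a)^{-m}\mathbf{1}\{a\le\underline{x}\le\overline{x}\le b\}$ of the minimum and maximum of $m$ i.i.d. $U(a,b)$ variables. *)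

theory Defs
  imports "HOL-Probability.Probability"
begin

text \<open>
  A vector \<open>x\<^sub>1, \<dots>, x\<^sub>m\<close> is a list; \<open>order_stat l xs\<close> is the \<open>l\<close>-th smallest
  entry, counted from 1 and with multiplicity (meaningful for \<open>1 \<le> l \<le> length xs\<close>).
\<close>
definition order_stat :: "nat \<Rightarrow> real list \<Rightarrow> real" where
  "order_stat l xs = sort xs ! (l - 1)"

text \<open>A closed interval is represented by the pair of its end points.\<close>
definition order_interval :: "nat \<Rightarrow> nat \<Rightarrow> real list \<Rightarrow> real \<times> real" where
  "order_interval l u xs = (order_stat l xs, order_stat u xs)"

lemma order_interval_1_length:
  assumes "xs \<noteq> []"
  shows "order_interval 1 (length xs) xs = (Min (set xs), Max (set xs))"
proof -
  have ne: "sort xs \<noteq> []" using assms by (metis length_0_conv length_sort)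
  have "sort xs ! 0 = Min (set xs)"
  proof (rule Min_eqI[symmetric])
    fix y assume "y \<in> set xs"
    then obtain i where "i < length xs" "y = sort xs ! i"
      by (metis in_set_conv_nth length_sort set_sort)
    then show "sort xs ! 0 \<le> y"
      by (metis sorted_nth_mono le0 length_sort sorted_sort)
  next
    show "sort xs ! 0 \<in> set xs"
      using ne by (metis length_greater_0_conv nth_mem set_sort)
  qed simp
  moreover have "sort xs ! (length xs - 1) = Max (set xs)"
  proof (rule Max_eqI[symmetric])
    fix y assume "y \<in> set xs"
    then obtain i where i: "i < length xs" "y = sort xs ! i"
      by (metis in_set_conv_nth length_sort set_sort)
    then show "y \<le> sort xs ! (length xs - 1)"
      by (simp add: sorted_nth_mono)
  next
    show "sort xs ! (length xs - 1) \<in> set xs"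
      using assms by (metis diff_less length_greater_0_conv length_sort nth_mem set_sort zero_less_one)
  qed simp
  ultimately show ?thesis
    by (simp add: order_interval_def order_stat_def)
qed

text \<open>
  Conditionally on \<open>(A, B)\<close>, the variables \<open>X 1, \<dots>, X m\<close> are i.i.d. uniform on \<open>[A, B]\<close>:
  for all Borel sets \<open>S\<^sub>1, \<dots>, S\<^sub>m\<close>, almost surely
  \<open>P(X\<^sub>1 \<in> S\<^sub>1, \<dots>, X\<^sub>m \<in> S\<^sub>m | A, B) = (\<Prod>k. U(A, B)(S\<^sub>k))\<close>. The conditional probability is the
  conditional expectation of the indicator given the sigma-algebra generated by \<open>(A, B)\<close>.
  If \<open>A \<ge> B\<close>, \<open>uniform_measure lborel {A..B}\<close> is the zero measure; this event is null whenever
  \<open>(A, B)\<close> has a density vanishing on \<open>a > b\<close>.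
\<close>
definition cond_iid_uniform ::
  "'w measure \<Rightarrow> nat \<Rightarrow> ('w \<Rightarrow> real) \<Rightarrow> ('w \<Rightarrow> real) \<Rightarrow> (nat \<Rightarrow> 'w \<Rightarrow> real) \<Rightarrow> bool" where
  "cond_iid_uniform M m A B X \<longleftrightarrow>
     (\<forall>k\<in>{1..m}. X k \<in> borel_measurable M) \<and>
     (\<forall>S. (\<forall>k\<in>{1..m}. S k \<in> sets borel) \<longrightarrow>
        (AE \<omega> in M.
           real_cond_exp M (vimage_algebra (space M) (\<lambda>\<omega>. (A \<omega>, B \<omega>)) borel)
             (indicator {\<omega> \<in> space M. \<forall>k\<in>{1..m}. X k \<omega> \<in> S k}) \<omega>
           = (\<Prod>k\<in>{1..m}. measure (uniform_measure lborel {A \<omega>..B \<omega>}) (S k))))"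

text \<open>
  Meaningful as a density only for \<open>m \<ge> 2\<close> and \<open>x \<le> y\<close>; for \<open>x > y\<close> the formula is not the
  density (which is 0 there).
\<close>
definition f_minmax :: "(real \<times> real \<Rightarrow> real) \<Rightarrow> nat \<Rightarrow> real \<Rightarrow> real \<Rightarrow> real" where
  "f_minmax \<pi> m x y =
     (LINT (a, b):{(a, b). a \<le> x \<and> y \<le> b}|lborel.
        real m * (real m - 1) * ((y - x) ^ (m - 2) / (b - a) ^ m) * \<pi> (a, b))"

end

theory Submission
  imports Defs "HOL-Real_Asymp.Real_Asymp"
begin

text \<open>
  The joint law of minimum and maximum is determined by the events
  \<open>p \<le> min, max \<le> q\<close>, on which all \<open>X k\<close> lie in \<open>[p, q]\<close>; given \<open>(a, b)\<close> this has
  probability \<open>(|[a, b] \<inter> [p, q]| / (b - a))\<^sup>m\<close>, which is the integral of the kernel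
  \<open>m (m - 1) (y - x)\<^sup>m\<^sup>-\<^sup>2 / (b - a)\<^sup>m\<close>, so Tonelli gives the density.
  For the limit with \<open>x < y\<close> and \<open>L = y - x\<close>, the substitution \<open>(a, b) = (x + s / m, y + t / m)\<close>
  with \<open>s \<le> 0 \<le> t\<close> turns the kernel into \<open>(1 - 1/m) L\<^sup>-\<^sup>2 (1 + (t - s) / (L m))\<^sup>-\<^sup>m\<close>, which
  tends to \<open>L\<^sup>-\<^sup>2 exp (- (t - s) / L)\<close>, of total mass 1. On the diagonal both sides vanish.
\<close>

section \<open>Measures and integrals on the plane\<close>

text \<open>The quadrants \<open>{p..} \<times> {..q}\<close> are closed under intersection and
  generate the Borel sets of the plane, so the uniqueness theorem for measures on a generator
  applies. These quadrants are chosen because (min, max) lies in one of them exactly when every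
  sample point lies in \<open>{p..q}\<close>.\<close>

lemma borel_measure_eqI_rays:
  fixes M N :: "(real \<times> real) measure"
  assumes "finite_measure M" "sets M = sets borel" "sets N = sets borel"
    and eq: "\<And>p q. emeasure M ({p..} \<times> {..q}) = emeasure N ({p..} \<times> {..q})"
  shows "M = N"
proof -
  interpret finite_measure M by fact
  define E :: "(real \<times> real) set set"
    where "E = {a \<times> b |a b. a \<in> range atLeast \<and> b \<in> range atMost}"
  have "sets (borel \<Otimes>\<^sub>M borel :: (real \<times> real) measure) = sets (sigma (space borel \<times> space borel) E)"
    unfolding E_def
  proof (rule sets_pair_eq)
    show "sets borel = sigma_sets (space borel) (range (atLeast :: real \<Rightarrow> _))"
      by (subst borel_Ici) simp
    show "sets borel = sigma_sets (space borel) (range (atMost :: real \<Rightarrow> _))"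
      by (subst borel_eq_atMost) simp
    show "countable (range (\<lambda>n::nat. {- real n..}))" "countable (range (\<lambda>n::nat. {..real n}))"
      by auto
    show "(\<Union>n::nat. {- real n..}) = space borel"
    proof safe
      fix x :: real
      obtain n :: nat where "- x \<le> real n" using real_arch_simple by blast
      then show "x \<in> (\<Union>n::nat. {- real n..})" by (auto intro!: exI[of _ n])
    qed auto
    show "(\<Union>n::nat. {..real n}) = space borel"
      using real_arch_simple by auto
  qed auto
  then have E: "sets borel = sigma_sets UNIV E"
    unfolding borel_prod by (subst (asm) sets_measure_of) (auto simp: E_def)
  show ?thesis
  \<comment> \<open>The quadrants with corner \<open>(- n, n)\<close> exhaust the plane, and each
    has finite measure because \<open>M\<close> is finite.\<close>
  proof (rule measure_eqI_generator_eq[where \<Omega> = UNIV and E = E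
        and A = "\<lambda>n. {- real n..} \<times> {..real n}"])
    show "Int_stable E"
    proof (rule Int_stableI)
      fix S T assume "S \<in> E" "T \<in> E"
      then obtain p q p' q' where "S = {p..} \<times> {..q}" "T = {p'..} \<times> {..q'}"
        unfolding E_def by blast
      then have "S \<inter> T = {max p p'..} \<times> {..min q q'}" by auto
      then show "S \<inter> T \<in> E" unfolding E_def by blast
    qed
    show "emeasure M S = emeasure N S" if "S \<in> E" for S
      using that eq unfolding E_def by auto
    show "(\<Union>n. {- real n..} \<times> {..real n}) = UNIV"
    proof safe
      fix x y :: real
      obtain n :: nat where "max (- x) y \<le> real n" using real_arch_simple by blast
      then show "(x, y) \<in> (\<Union>n. {- real n..} \<times> {..real n})" by (auto intro!: exI[of _ n])
    qed auto
    show "emeasure M ({- real n..} \<times> {..real n}) \<noteq> \<infinity>" for n by simp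
    show "range (\<lambda>n. {- real n..} \<times> {..real n}) \<subseteq> E" unfolding E_def by blast
  qed (use assms E in auto)
qed

text \<open>Integrate twice by the fundamental theorem. In \<open>t\<close> the antiderivative is
  \<open>m * (t - s) ^ (m - 1)\<close>, which vanishes at \<open>t = s\<close> because
  \<open>m \<ge> 2\<close>; in \<open>s\<close> it is \<open>- ((d - s) ^ m)\<close>.\<close>

lemma nn_integral_simplex_power:
  fixes c d :: real and m :: nat
  assumes "m \<ge> 2" "c \<le> d"
  shows "(\<integral>\<^sup>+z. ennreal (real m * (real m - 1) * (snd z - fst z) ^ (m - 2)) *
            indicator {(s, t). c \<le> s \<and> s \<le> t \<and> t \<le> d} z \<partial>lborel) = ennreal ((d - c) ^ m)"
proof -
  obtain k where m: "m = Suc (Suc k)" using \<open>m \<ge> 2\<close> by (metis add_2_eq_Suc le_Suc_ex)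
  let ?f = "\<lambda>z::real \<times> real. ennreal (real m * (real m - 1) * (snd z - fst z) ^ k) *
            indicator {(s, t). c \<le> s \<and> s \<le> t \<and> t \<le> d} z"
  have meas: "?f \<in> borel_measurable borel"
    unfolding borel_prod[symmetric] case_prod_beta by measurable
  have inner: "(\<integral>\<^sup>+t. ?f (s, t) \<partial>lborel) = ennreal (m * (d - s) ^ Suc k) * indicator {c..d} s" for s
  proof (cases "c \<le> s \<and> s \<le> d")
    case True
    have "(\<integral>\<^sup>+t. ?f (s, t) \<partial>lborel) =
        (\<integral>\<^sup>+t. ennreal (real m * (real m - 1) * (t - s) ^ k) * indicator {s..d} t \<partial>lborel)"
      using True by (intro nn_integral_cong) (auto split: split_indicator)
    also have "\<dots> = ennreal (m * (d - s) ^ Suc k - m * (s - s) ^ Suc k)"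
    proof (rule nn_integral_FTC_Icc)
      show "((\<lambda>t. m * (t - s) ^ Suc k) has_real_derivative real m * (real m - 1) * (t - s) ^ k) (at t)"
        for t unfolding m by (rule derivative_eq_intros refl | simp)+
    qed (use True in \<open>auto simp: m\<close>)
    finally show ?thesis using True by simp
  qed (auto intro!: nn_integral_zero' split: split_indicator)
  have "(\<integral>\<^sup>+z. ?f z \<partial>lborel) = (\<integral>\<^sup>+s. \<integral>\<^sup>+t. ?f (s, t) \<partial>lborel \<partial>lborel)"
    using meas by (subst lborel_prod[symmetric], subst lborel.nn_integral_fst)
      (simp_all add: lborel_prod)
  also have "\<dots> = ennreal (- ((d - d) ^ m) - - ((d - c) ^ m))"
    unfolding inner
  proof (rule nn_integral_FTC_Icc)
    show "((\<lambda>s. - ((d - s) ^ m)) has_real_derivative real m * (d - s) ^ Suc k) (at s)" for s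
      unfolding m by (rule derivative_eq_intros refl | simp)+
  qed (use assms in auto)
  finally show ?thesis using m by simp
qed

section \<open>Boundary values of the prior density and the mixture integral\<close>

text \<open>The points \<open>(a, a - 1 / (n + 1))\<close> lie where \<open>\<pi>\<close> vanishes
  and tend to \<open>(a, a)\<close>. This settles the degenerate intervals \<open>a = b\<close>,
  both as parameters and as arguments of the limit.\<close>

lemma continuous_zero_diagonal:
  fixes \<pi> :: "real \<times> real \<Rightarrow> real"
  assumes "continuous_on UNIV \<pi>" "\<And>a b. a > b \<Longrightarrow> \<pi> (a, b) = 0"
  shows "\<pi> (a, a) = 0"
proof (rule LIMSEQ_unique)
  have "(\<lambda>n. (a, a - inverse (real (Suc n)))) \<longlonglongrightarrow> (a, a - 0)"
    by (intro tendsto_intros LIMSEQ_inverse_real_of_nat)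
  then show "(\<lambda>n. \<pi> (a, a - inverse (real (Suc n)))) \<longlonglongrightarrow> \<pi> (a, a)"
    using continuous_on_tendsto_compose[OF assms(1)] by fastforce
  show "(\<lambda>n. \<pi> (a, a - inverse (real (Suc n)))) \<longlonglongrightarrow> 0"
    using assms(2) by simp
qed

text \<open>On the domain of integration \<open>b - a \<ge> y - x > 0\<close>, so the kernel is
  bounded by its value at \<open>b - a = y - x\<close>, and its product with the integrable
  \<open>\<pi>\<close> is integrable. Hence the Bochner integral in \<open>f_minmax\<close> is a
  genuine value and not the default 0, and Tonelli can be applied to the nonnegative integral
  instead.\<close>

lemma ennreal_f_minmax:
  assumes "m \<ge> 2" "x < y" "integrable lborel \<pi>" and nonneg: "\<And>z. 0 \<le> \<pi> z"
  shows "ennreal (f_minmax \<pi> m x y) = (\<integral>\<^sup>+z. ennreal (\<pi> z) *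
     (ennreal (real m * (real m - 1) * ((y - x) ^ (m - 2) / (snd z - fst z) ^ m)) *
      indicator {(a, b). a \<le> x \<and> y \<le> b} z) \<partial>lborel)"
proof -
  let ?S = "{(a, b). a \<le> x \<and> y \<le> b}"
  let ?K = "\<lambda>z::real\<times>real. real m * (real m - 1) * ((y - x) ^ (m - 2) / (snd z - fst z) ^ m)"
  let ?g = "\<lambda>z. \<pi> z * (?K z * indicator ?S z)"
  have [measurable]: "\<pi> \<in> borel_measurable borel"
    using assms(3) by (auto dest: borel_measurable_integrable)
  have [measurable]: "(\<lambda>z. ?K z * indicator ?S z) \<in> borel_measurable borel"
    unfolding borel_prod[symmetric] case_prod_beta by measurable
  have bound: "0 \<le> ?K z * indicator ?S z \<and> ?K z * indicator ?S z
      \<le> real m * (real m - 1) * ((y - x) ^ (m - 2) / (y - x) ^ m)" for z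
    using assms(1,2) by (auto split: split_indicator intro!: mult_left_mono divide_left_mono power_mono)
  have "integrable lborel ?g"
  proof (rule Bochner_Integration.integrable_bound)
    show "integrable lborel (\<lambda>z. \<pi> z * (real m * (real m - 1) * ((y - x) ^ (m - 2) / (y - x) ^ m)))"
      using assms(3) by (rule integrable_mult_left)
    show "AE z in lborel. norm (?g z) \<le>
        norm (\<pi> z * (real m * (real m - 1) * ((y - x) ^ (m - 2) / (y - x) ^ m)))"
    proof (rule AE_I2)
      fix z
      have "norm (?g z) = ?g z"
        using bound nonneg by (simp only: real_norm_def abs_of_nonneg mult_nonneg_nonneg)
      also have "\<dots> \<le> \<pi> z * (real m * (real m - 1) * ((y - x) ^ (m - 2) / (y - x) ^ m))"
        using bound nonneg by (blast intro: mult_left_mono)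
      finally show "norm (?g z) \<le>
          norm (\<pi> z * (real m * (real m - 1) * ((y - x) ^ (m - 2) / (y - x) ^ m)))"
        unfolding real_norm_def by (rule order_trans[OF _ abs_ge_self])
    qed
  qed measurable
  moreover have "f_minmax \<pi> m x y = (\<integral>z. ?g z \<partial>lborel)"
    unfolding f_minmax_def set_lebesgue_integral_def
    by (intro Bochner_Integration.integral_cong) (auto split: split_indicator)
  moreover have "0 \<le> ?g z" for z
    using bound nonneg by (blast intro: mult_nonneg_nonneg)
  ultimately have "ennreal (f_minmax \<pi> m x y) = (\<integral>\<^sup>+z. ennreal (?g z) \<partial>lborel)"
    by (simp add: nn_integral_eq_integral)
  also have "\<dots> = (\<integral>\<^sup>+z. ennreal (\<pi> z) * (ennreal (?K z) * indicator ?S z) \<partial>lborel)"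
  proof (rule nn_integral_cong)
    fix z
    have "ennreal (?K z * indicator ?S z) = ennreal (?K z) * indicator ?S z"
      by (auto split: split_indicator)
    then show "ennreal (?g z) = ennreal (\<pi> z) * (ennreal (?K z) * indicator ?S z)"
      using nonneg bound by (subst ennreal_mult) auto
  qed
  finally show ?thesis .
qed

section \<open>Probability that the whole sample lies in a given interval\<close>

lemma borel_measurable_fst_snd_borel [measurable]:
  "fst \<in> borel_measurable (borel :: (real \<times> real) measure)"
  "snd \<in> borel_measurable (borel :: (real \<times> real) measure)"
  by (auto intro!: borel_measurable_continuous_onI continuous_intros)

text \<open>For \<open>a < b\<close> this is the \<open>U(a, b)\<close>-probability of
  \<open>{p..q}\<close>, that is, the length of the intersection divided by \<open>b - a\<close>.
  The closed formula makes measurability in \<open>(a, b)\<close> immediate; for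
  \<open>a \<ge> b\<close> it takes the value 0.\<close>

definition uniform_mass :: "real \<Rightarrow> real \<Rightarrow> real \<times> real \<Rightarrow> real" where
  "uniform_mass p q z = max 0 (min (snd z) q - max (fst z) p) / (snd z - fst z)"

lemma uniform_mass_measurable [measurable]: "uniform_mass p q \<in> borel_measurable borel"
  unfolding uniform_mass_def by measurable

lemma measure_uniform_Icc:
  fixes a b :: real
  assumes "a < b"
  shows "measure (uniform_measure lborel {a..b}) {p..q} = uniform_mass p q (a, b)"
proof -
  have "{a..b} \<inter> {p..q} = {max a p..min b q}" by auto
  then show ?thesis
    using assms by (subst measure_uniform_measure) (auto simp: uniform_mass_def)
qed

text \<open>The probability of the event is the expectation of its conditional probability given
  \<open>(A, B)\<close>. By conditional independence the latter is
  \<open>uniform_mass p q (A, B) ^ m\<close>, and the density of \<open>(A, B)\<close> turns the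
  expectation into an integral against \<open>\<pi>\<close>.\<close>

lemma emeasure_all_in_Icc:
  assumes "prob_space M" and nonneg: "\<And>z. 0 \<le> \<pi> z"
    and zero: "\<And>a b. a \<ge> b \<Longrightarrow> \<pi> (a, b) = 0"
    and D: "distributed M lborel (\<lambda>\<omega>. (A \<omega>, B \<omega>)) (\<lambda>z. ennreal (\<pi> z))"
    and X: "cond_iid_uniform M m A B X"
  shows "emeasure M {\<omega> \<in> space M. \<forall>k\<in>{1..m}. X k \<omega> \<in> {p..q}}
    = (\<integral>\<^sup>+z. ennreal (\<pi> z) * ennreal (uniform_mass p q z ^ m) \<partial>lborel)"
proof -
  interpret prob_space M by fact
  let ?F = "vimage_algebra (space M) (\<lambda>\<omega>. (A \<omega>, B \<omega>)) borel"
  let ?E = "{\<omega> \<in> space M. \<forall>k\<in>{1..m}. X k \<omega> \<in> {p..q}}"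
  let ?u = "\<lambda>\<omega>. uniform_mass p q (A \<omega>, B \<omega>) ^ m"
  have X_meas: "X k \<in> borel_measurable M" if "k \<in> {1..m}" for k
    using X that unfolding cond_iid_uniform_def by blast
  have E: "?E \<in> sets M"
  proof -
    have "X k -` {p..q} \<inter> space M \<in> sets M" if "k \<in> {1..m}" for k
      using X_meas[OF that] by (rule measurable_sets) simp
    then have "{\<omega> \<in> space M. X k \<omega> \<in> {p..q}} \<in> sets M" if "k \<in> {1..m}" for k
      using that by (simp add: vimage_def Int_def conj_commute)
    then show ?thesis by (intro sets.sets_Collect_finite_All) auto
  qed
  have AB [measurable]: "(\<lambda>\<omega>. (A \<omega>, B \<omega>)) \<in> M \<rightarrow>\<^sub>M borel"
    using distributed_measurable[OF D] by simp
  have "subalgebra M ?F"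
    unfolding subalgebra_def using measurable_sets[OF AB] by (auto simp: sets_vimage_algebra2)
  then interpret finite_measure_subalgebra M ?F
    by unfold_locales
  have int: "integrable M (indicator ?E :: _ \<Rightarrow> real)"
    by (rule integrable_real_indicator[OF E]) (simp add: emeasure_eq_measure)
  \<comment> \<open>Since \<open>\<pi>\<close> vanishes for \<open>a \<ge> b\<close>, the degenerate
    parameters, where the uniform measure is the zero measure, form a null event.\<close>
  have "AE \<omega> in M. A \<omega> < B \<omega>"
  proof -
    have "Measurable.pred borel (\<lambda>z :: real \<times> real. fst z < snd z)" by measurable
    then have "AE \<omega> in M. fst (A \<omega>, B \<omega>) < snd (A \<omega>, B \<omega>)"
      using D zero by (subst distributed_AE2) (auto simp: not_le[symmetric])
    then show ?thesis by simp
  qed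
  moreover have "AE \<omega> in M. real_cond_exp M ?F (indicator ?E) \<omega>
      = (\<Prod>k\<in>{1..m}. measure (uniform_measure lborel {A \<omega>..B \<omega>}) {p..q})"
    using X[unfolded cond_iid_uniform_def, THEN conjunct2, rule_format, of "\<lambda>_. {p..q}"] by simp
  ultimately have AE: "AE \<omega> in M. real_cond_exp M ?F (indicator ?E) \<omega> = ?u \<omega>"
    by eventually_elim (simp only: measure_uniform_Icc prod_constant card_atLeastAtMost diff_Suc_1)
  \<comment> \<open>Integrability is inherited from the conditional expectation, with which
    \<open>?u\<close> agrees almost everywhere.\<close>
  have int_u: "integrable M ?u"
    using real_cond_exp_int(1)[OF int] by (rule integrable_cong_AE_imp) (use AE in auto)
  have "emeasure M ?E = ennreal (\<integral>\<omega>. indicator ?E \<omega> \<partial>M)"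
    using E by (simp add: emeasure_eq_measure)
  also have "(\<integral>\<omega>. indicator ?E \<omega> \<partial>M) = (\<integral>\<omega>. real_cond_exp M ?F (indicator ?E) \<omega> \<partial>M)"
    using real_cond_exp_int(2)[OF int] by simp
  also have "\<dots> = (\<integral>\<omega>. ?u \<omega> \<partial>M)"
    using AE by (intro integral_cong_AE) auto
  also have "ennreal \<dots> = (\<integral>\<^sup>+\<omega>. ennreal (?u \<omega>) \<partial>M)"
  proof (rule nn_integral_eq_integral[symmetric, OF int_u])
    show "AE \<omega> in M. 0 \<le> ?u \<omega>"
      using \<open>AE \<omega> in M. A \<omega> < B \<omega>\<close> by eventually_elim (simp add: uniform_mass_def)
  qed
  also have "\<dots> = (\<integral>\<^sup>+z. ennreal (\<pi> z) * ennreal (uniform_mass p q z ^ m) \<partial>lborel)"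
    using D by (subst distributed_nn_integral[where X = "\<lambda>\<omega>. (A \<omega>, B \<omega>)"]) auto
  finally show ?thesis .
qed

text \<open>Inside the quadrant the constraint \<open>a \<le> x \<le> y \<le> b\<close> becomes
  \<open>c \<le> x \<le> y \<le> d\<close> with \<open>c = max a p\<close> and
  \<open>d = min b q\<close>. The simplex integral gives \<open>(d - c) ^ m\<close>, to be divided
  by \<open>(b - a) ^ m\<close>. If \<open>c > d\<close>, both sides are 0.\<close>

lemma nn_integral_minmax_kernel:
  assumes "m \<ge> 2" "a < b"
  shows "(\<integral>\<^sup>+w. ennreal (real m * (real m - 1) * ((snd w - fst w) ^ (m - 2) / (b - a) ^ m)) *
      indicator {(x, y). a \<le> x \<and> x \<le> y \<and> y \<le> b} w * indicator ({p..} \<times> {..q}) w \<partial>lborel)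
    = ennreal (uniform_mass p q (a, b) ^ m)"
proof -
  define c where "c = max a p"
  define d where "d = min b q"
  let ?T = "{(s, t). c \<le> s \<and> s \<le> t \<and> t \<le> d}"
  have [measurable]: "(\<lambda>w. ennreal (real m * (real m - 1) * (snd w - fst w) ^ (m - 2)) * indicator ?T w)
      \<in> borel_measurable borel"
    unfolding case_prod_beta by measurable
  have "(\<integral>\<^sup>+w. ennreal (real m * (real m - 1) * ((snd w - fst w) ^ (m - 2) / (b - a) ^ m)) *
      indicator {(x, y). a \<le> x \<and> x \<le> y \<and> y \<le> b} w * indicator ({p..} \<times> {..q}) w \<partial>lborel)
    = (\<integral>\<^sup>+w. ennreal (1 / (b - a) ^ m) *
        (ennreal (real m * (real m - 1) * (snd w - fst w) ^ (m - 2)) * indicator ?T w) \<partial>lborel)"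
    using assms
    by (intro nn_integral_cong)
      (auto split: split_indicator simp: c_def d_def ennreal_mult[symmetric])
  also have "\<dots> = ennreal (1 / (b - a) ^ m) *
      (\<integral>\<^sup>+w. ennreal (real m * (real m - 1) * (snd w - fst w) ^ (m - 2)) * indicator ?T w \<partial>lborel)"
    by (rule nn_integral_cmult) simp
  also have "\<dots> = ennreal (uniform_mass p q (a, b) ^ m)"
  proof (cases "c \<le> d")
    case True
    then have "uniform_mass p q (a, b) = (d - c) / (b - a)"
      by (simp add: uniform_mass_def c_def d_def)
    then show ?thesis
      using assms True
      by (simp add: nn_integral_simplex_power power_divide flip: ennreal_mult)
  next
    case False
    then have "uniform_mass p q (a, b) = 0"
      unfolding uniform_mass_def fst_conv snd_conv c_def[symmetric] d_def[symmetric] by simp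
    moreover have "(indicator ?T w :: ennreal) = 0" for w
      using False by (auto split: split_indicator)
    ultimately show ?thesis using assms by simp
  qed
  finally show ?thesis .
qed

section \<open>Joint density of minimum and maximum\<close>

text \<open>For each first coordinate only a single second coordinate is excluded. The lemma serves
  to discard the diagonal, where \<open>ennreal_f_minmax\<close> gives no information.\<close>

lemma AE_lborel_fst_neq_snd: "AE w in lborel :: (real \<times> real) measure. fst w \<noteq> snd w"
proof -
  have "AE w in lborel \<Otimes>\<^sub>M (lborel :: real measure). fst w \<noteq> (snd w :: real)"
  proof (rule lborel_pair.AE_pair_measure)
    show "{w \<in> space (lborel \<Otimes>\<^sub>M lborel). fst w \<noteq> (snd w :: real)} \<in> sets (lborel \<Otimes>\<^sub>M lborel)"
      by measurable
    have "AE y in lborel. x \<noteq> y" for x :: real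
      using AE_lborel_singleton[of x] by eventually_elim auto
    then show "AE x in lborel. AE y in lborel. fst (x, y) \<noteq> (snd (x, y) :: real)"
      by simp
  qed
  then show ?thesis unfolding lborel_prod .
qed

text \<open>It suffices to compare the two measures on quadrants. The law of (min, max) gives the
  \<open>\<pi>\<close>-average of \<open>uniform_mass p q z ^ m\<close>; each such power is the
  kernel integrated over the quadrant, and exchanging the two integrations puts the mixture density
  inside.\<close>

lemma distributed_minmax:
  assumes "prob_space M" "m \<ge> 2" and nonneg: "\<And>z. 0 \<le> \<pi> z"
    and zero: "\<And>a b. a \<ge> b \<Longrightarrow> \<pi> (a, b) = 0"
    and D: "distributed M lborel (\<lambda>\<omega>. (A \<omega>, B \<omega>)) (\<lambda>z. ennreal (\<pi> z))"
    and X: "cond_iid_uniform M m A B X"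
  shows "distributed M lborel (\<lambda>\<omega>. (Min ((\<lambda>k. X k \<omega>) ` {1..m}), Max ((\<lambda>k. X k \<omega>) ` {1..m})))
    (\<lambda>(x, y). ennreal (if x \<le> y then f_minmax \<pi> m x y else 0))"
proof -
  interpret prob_space M by fact
  let ?Y = "\<lambda>\<omega>. (Min ((\<lambda>k. X k \<omega>) ` {1..m}), Max ((\<lambda>k. X k \<omega>) ` {1..m}))"
  let ?f = "\<lambda>w. ennreal (if fst w \<le> snd w then f_minmax \<pi> m (fst w) (snd w) else 0)"
  have [measurable]: "\<pi> \<in> borel_measurable borel"
    using distributed_real_measurable[OF nonneg D] by simp
  \<comment> \<open>The expectation of the constant 1 under a probability measure is 1, so the
    nonnegative \<open>\<pi>\<close> has total integral 1.\<close>
  have int_pi: "integrable lborel \<pi>"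
  proof (rule integrableI_nonneg)
    have "(\<integral>\<^sup>+z. ennreal (\<pi> z) * 1 \<partial>lborel) = 1"
      using D by (subst distributed_nn_integral[OF D]) (auto simp: emeasure_space_1)
    then show "(\<integral>\<^sup>+z. ennreal (\<pi> z) \<partial>lborel) < \<infinity>" by simp
  qed (use nonneg in auto)
  have X_meas: "X k \<in> borel_measurable M" if "k \<in> {1..m}" for k
    using X that unfolding cond_iid_uniform_def by blast
  have Y [measurable]: "?Y \<in> M \<rightarrow>\<^sub>M borel"
    unfolding borel_prod[symmetric] using X_meas
    by (intro measurable_Pair borel_measurable_Min borel_measurable_Max) auto
  have f_meas [measurable]: "?f \<in> borel_measurable borel"
  proof -
    have "(\<lambda>v :: (real \<times> real) \<times> (real \<times> real).
        indicator {(a, b). a \<le> fst (fst v) \<and> snd (fst v) \<le> b} (snd v) *\<^sub>R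
        (case snd v of (a, b) \<Rightarrow> real m * (real m - 1) *
          ((snd (fst v) - fst (fst v)) ^ (m - 2) / (b - a) ^ m) * \<pi> (a, b)))
      \<in> borel_measurable (borel \<Otimes>\<^sub>M lborel)"
      unfolding indicator_def case_prod_beta mem_Collect_eq prod.collapse by measurable
    then have [measurable]: "(\<lambda>w. f_minmax \<pi> m (fst w) (snd w)) \<in> borel_measurable borel"
      unfolding f_minmax_def set_lebesgue_integral_def
      by (intro lborel.borel_measurable_lebesgue_integral) (simp add: case_prod_beta)
    show ?thesis by measurable
  qed
  \<comment> \<open>The kernel as a function of the interval \<open>w = (x, y)\<close> and the
    parameters \<open>z = (a, b)\<close>. The constraint \<open>x \<le> y\<close> is built into the
    indicator, so that \<open>h\<close> vanishes where the density has to be 0.\<close>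
  define h where "h w z = ennreal (real m * (real m - 1) *
      ((snd w - fst w) ^ (m - 2) / (snd z - fst z) ^ m)) *
      indicator {(x, y). fst z \<le> x \<and> x \<le> y \<and> y \<le> snd z} w" for w z :: "real \<times> real"
  have f_eq: "?f w = (\<integral>\<^sup>+z. ennreal (\<pi> z) * h w z \<partial>lborel)" if "fst w \<noteq> snd w" for w
  proof (cases "fst w < snd w")
    case True
    have "?f w = (\<integral>\<^sup>+z. ennreal (\<pi> z) * (ennreal (real m * (real m - 1) *
        ((snd w - fst w) ^ (m - 2) / (snd z - fst z) ^ m)) *
        indicator {(a, b). a \<le> fst w \<and> snd w \<le> b} z) \<partial>lborel)"
      using True ennreal_f_minmax[OF \<open>m \<ge> 2\<close> True int_pi nonneg] by simp
    also have "\<dots> = (\<integral>\<^sup>+z. ennreal (\<pi> z) * h w z \<partial>lborel)"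
      using True by (intro nn_integral_cong) (auto simp: h_def split: split_indicator)
    finally show ?thesis .
  next
    case False
    then have "h w z = 0" for z
      using that by (auto simp: h_def split: split_indicator)
    then show ?thesis using False that by simp
  qed
  have "distr M borel ?Y = density lborel ?f"
  proof (rule borel_measure_eqI_rays)
    show "finite_measure (distr M borel ?Y)"
      by (rule finite_measure_distr[OF Y])
    fix p q :: real
    let ?Q = "{p..} \<times> {..q}"
    have Q [measurable]: "?Q \<in> sets borel"
      unfolding borel_prod[symmetric] by simp
    have "emeasure (distr M borel ?Y) ?Q = emeasure M (?Y -` ?Q \<inter> space M)"
      by (rule emeasure_distr[OF Y Q])
    also have "?Y -` ?Q \<inter> space M = {\<omega> \<in> space M. \<forall>k\<in>{1..m}. X k \<omega> \<in> {p..q}}"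
      using \<open>m \<ge> 2\<close> by auto
    also have "emeasure M \<dots> = (\<integral>\<^sup>+z. ennreal (\<pi> z) * ennreal (uniform_mass p q z ^ m) \<partial>lborel)"
      using assms by (intro emeasure_all_in_Icc) auto
    also have "\<dots> = (\<integral>\<^sup>+z. \<integral>\<^sup>+w. ennreal (\<pi> z) * h w z * indicator ?Q w \<partial>lborel \<partial>lborel)"
    proof (rule nn_integral_cong)
      fix z :: "real \<times> real"
      obtain a b where z: "z = (a, b)" by (cases z)
      show "ennreal (\<pi> z) * ennreal (uniform_mass p q z ^ m)
          = (\<integral>\<^sup>+w. ennreal (\<pi> z) * h w z * indicator ?Q w \<partial>lborel)"
      \<comment> \<open>Only \<open>a < b\<close> calls for the kernel integral; otherwise the
        weight \<open>\<pi> z\<close> makes both sides 0.\<close>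
      proof (cases "a < b")
        case True
        have "(\<lambda>w. h w z * indicator ?Q w) \<in> borel_measurable borel"
          unfolding h_def indicator_def case_prod_beta mem_Collect_eq by measurable
        then have "(\<integral>\<^sup>+w. ennreal (\<pi> z) * h w z * indicator ?Q w \<partial>lborel)
            = ennreal (\<pi> z) * (\<integral>\<^sup>+w. h w z * indicator ?Q w \<partial>lborel)"
          by (simp add: mult.assoc nn_integral_cmult)
        also have "(\<integral>\<^sup>+w. h w z * indicator ?Q w \<partial>lborel) = ennreal (uniform_mass p q z ^ m)"
          using nn_integral_minmax_kernel[OF \<open>m \<ge> 2\<close> True] unfolding z h_def by simp
        finally show ?thesis by simp
      qed (simp add: z zero)
    qed
    also have "\<dots> = (\<integral>\<^sup>+w. \<integral>\<^sup>+z. ennreal (\<pi> z) * h w z * indicator ?Q w \<partial>lborel \<partial>lborel)"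
    proof (rule lborel_pair.Fubini')
      show "(\<lambda>(w, z). ennreal (\<pi> z) * h w z * indicator ?Q w)
          \<in> borel_measurable (lborel \<Otimes>\<^sub>M lborel)"
        unfolding h_def indicator_def case_prod_beta mem_Collect_eq by measurable
    qed
    also have "\<dots> = (\<integral>\<^sup>+w. ?f w * indicator ?Q w \<partial>lborel)"
    proof (rule nn_integral_cong_AE)
      show "AE w in lborel. (\<integral>\<^sup>+z. ennreal (\<pi> z) * h w z * indicator ?Q w \<partial>lborel)
          = ?f w * indicator ?Q w"
        using AE_lborel_fst_neq_snd
      proof eventually_elim
        case (elim w)
        show ?case unfolding f_eq[OF elim] by (auto split: split_indicator)
      qed
    qed
    also have "\<dots> = emeasure (density lborel ?f) ?Q"
      by (subst emeasure_density) auto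
    finally show "emeasure (distr M borel ?Y) ?Q = emeasure (density lborel ?f) ?Q" .
  qed auto
  then have "distr M lborel ?Y = density lborel ?f"
    by (simp cong: distr_cong)
  then show ?thesis
    unfolding distributed_def case_prod_beta using Y f_meas by (simp del: One_nat_def)
qed

section \<open>Rescaling around the limit point\<close>

text \<open>Tonelli splits the integral into two factors, and the reflection
  \<open>s \<mapsto> - s\<close> shows that both equal \<open>I\<close>. It is applied to functions
  \<open>f\<close> supported on \<open>{0..}\<close>, whose product lives on the quadrant
  \<open>s \<le> 0 \<le> t\<close> of the rescaled variables, once for the limit kernel and once for
  the dominating function.\<close>

lemma has_bochner_integral_orthant_product:
  fixes f :: "real \<Rightarrow> real"
  assumes [measurable]: "f \<in> borel_measurable borel" and nonneg: "\<And>t. 0 \<le> f t"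
    and I: "(\<integral>\<^sup>+t. ennreal (f t) \<partial>lborel) = ennreal I" "0 \<le> I"
  shows "has_bochner_integral lborel (\<lambda>z::real \<times> real. f (- fst z) * f (snd z)) (I\<^sup>2)"
proof (rule has_bochner_integral_nn_integral)
  have reflect: "(\<integral>\<^sup>+s. ennreal (f (- s)) \<partial>lborel) = ennreal I"
    using nn_integral_real_affine[of "\<lambda>t. ennreal (f t)" "-1" 0] I by simp
  have [measurable]: "(\<lambda>z::real \<times> real. ennreal (f (- fst z) * f (snd z))) \<in> borel_measurable borel"
    unfolding borel_prod[symmetric] by measurable
  have "(\<integral>\<^sup>+z. ennreal (f (- fst (z :: real \<times> real)) * f (snd z)) \<partial>lborel)
      = (\<integral>\<^sup>+s. \<integral>\<^sup>+t. ennreal (f (- s) * f t) \<partial>lborel \<partial>lborel)"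
    by (subst lborel_prod[symmetric], subst lborel.nn_integral_fst[symmetric])
      (simp_all add: lborel_prod)
  also have "\<dots> = ennreal I * ennreal I"
    by (simp add: ennreal_mult nonneg nn_integral_cmult nn_integral_multc I reflect)
  finally show "(\<integral>\<^sup>+z. ennreal (f (- fst (z :: real \<times> real)) * f (snd z)) \<partial>lborel) = ennreal (I\<^sup>2)"
    by (simp add: ennreal_mult I power2_eq_square)
  have "(\<lambda>z::real \<times> real. f (- fst z) * f (snd z)) \<in> borel_measurable borel"
    unfolding borel_prod[symmetric] by measurable
  then show "(\<lambda>z::real \<times> real. f (- fst z) * f (snd z)) \<in> borel_measurable lborel"
    by simp
qed (use nonneg in auto)

lemma lborel_integral_affine:
  fixes g :: "'a::euclidean_space \<Rightarrow> real"
  assumes [measurable]: "g \<in> borel_measurable borel" and "c > 0"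
  shows "(\<integral>z. g z \<partial>lborel) = (\<integral>z. c ^ DIM('a) * g (t + c *\<^sub>R z) \<partial>lborel)"
  using \<open>c > 0\<close>
  by (subst lborel_affine[of c t], simp)
    (subst integral_density, auto simp: integral_distr)

text \<open>Under \<open>(a, b) = (x + s / m, y + t / m)\<close> the domain becomes
  \<open>s \<le> 0 \<le> t\<close> and the Jacobian is \<open>1 / m\<^sup>2\<close>. The Jacobian
  turns \<open>m (m - 1)\<close> into \<open>1 - 1 / m\<close>, and the powers of
  \<open>y - x\<close> cancel down to \<open>1 / (y - x)\<^sup>2\<close>.\<close>

lemma f_minmax_rescaled:
  fixes \<pi> :: "real \<times> real \<Rightarrow> real"
  assumes "m \<ge> 2" "x < y" and [measurable]: "\<pi> \<in> borel_measurable borel"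
  shows "f_minmax \<pi> m x y = (\<integral>z. indicator {..0} (fst z) * indicator {0..} (snd z) *
      ((1 - 1 / real m) / (y - x)\<^sup>2 / (1 + (snd z - fst z) / (y - x) / real m) ^ m *
        \<pi> ((x, y) + (1 / real m) *\<^sub>R z)) \<partial>lborel)"
proof -
  let ?S = "{(a, b). a \<le> x \<and> y \<le> b}"
  let ?g = "\<lambda>z::real\<times>real. indicator ?S z *
      (real m * (real m - 1) * ((y - x) ^ (m - 2) / (snd z - fst z) ^ m) * \<pi> z)"
  obtain k where m: "m = Suc (Suc k)" using \<open>m \<ge> 2\<close> by (metis add_2_eq_Suc le_Suc_ex)
  have [measurable]: "(\<lambda>z::real \<times> real. indicator ?S z *
      (real m * (real m - 1) * ((y - x) ^ (m - 2) / (snd z - fst z) ^ m)) :: real) \<in> borel_measurable borel"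
    unfolding borel_prod[symmetric] case_prod_beta by measurable
  have "(\<lambda>z. (indicator ?S z *
      (real m * (real m - 1) * ((y - x) ^ (m - 2) / (snd z - fst z) ^ m))) * \<pi> z) \<in> borel_measurable borel"
    by measurable
  then have "?g \<in> borel_measurable borel"
    by (simp only: mult.assoc)
  moreover have "f_minmax \<pi> m x y = (\<integral>z. ?g z \<partial>lborel)"
    unfolding f_minmax_def set_lebesgue_integral_def
    by (intro Bochner_Integration.integral_cong) (auto split: split_indicator)
  ultimately have "f_minmax \<pi> m x y
      = (\<integral>z. (1 / real m) ^ DIM(real \<times> real) * ?g ((x, y) + (1 / real m) *\<^sub>R z) \<partial>lborel)"
    using m by (simp only:) (rule lborel_integral_affine, auto)
  also have "\<dots> = (\<integral>z. indicator {..0} (fst z) * indicator {0..} (snd z) *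
      ((1 - 1 / real m) / (y - x)\<^sup>2 / (1 + (snd z - fst z) / (y - x) / real m) ^ m *
        \<pi> ((x, y) + (1 / real m) *\<^sub>R z)) \<partial>lborel)"
  proof (rule Bochner_Integration.integral_cong[OF refl])
    fix z :: "real \<times> real"
    obtain s t where z: "z = (s, t)" by (cases z)
    define L where "L = y - x"
    have L: "L > 0" using \<open>x < y\<close> by (simp add: L_def)
    \<comment> \<open>The new length \<open>b - a\<close> is factored as \<open>L\<close> times a
      number close to 1, so that \<open>L ^ m\<close> in the denominator can cancel against
      \<open>L ^ (m - 2)\<close>.\<close>
    have shift: "y + t / m - (x + s / m) = L * (1 + (t - s) / L / m)"
    proof -
      have "L * (1 + (t - s) / L / m) = L + (t - s) / m"
        using L by (simp add: distrib_left)
      then show ?thesis by (simp add: L_def diff_divide_distrib)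
    qed
    have power: "L ^ (m - 2) / (L * q) ^ m = 1 / L\<^sup>2 / q ^ m" for q
      using L unfolding power_mult_distrib m by (simp add: power2_eq_square)
    have "(1 / real m)\<^sup>2 * (real m * (real m - 1)) = 1 - 1 / real m"
    proof -
      have "real m \<noteq> 0" using m by simp
      then show ?thesis by (simp add: power2_eq_square field_simps)
    qed
    then have scale: "(1 / real m)\<^sup>2 * (real m * (real m - 1) * (L ^ (m - 2) / (L * (1 + (t - s) / L / m)) ^ m))
        = (1 - 1 / real m) / L\<^sup>2 / (1 + (t - s) / L / real m) ^ m"
      unfolding power mult.assoc[symmetric] by simp
    define w where "w = (x, y) + (1 / real m) *\<^sub>R z"
    have diff: "snd w - fst w = L * (1 + (t - s) / L / m)"
      using shift by (simp add: w_def z)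
    have dim: "DIM(real \<times> real) = 2" by simp
    have weight: "(1 / real m) ^ DIM(real \<times> real) *
        (real m * (real m - 1) * (L ^ (m - 2) / (snd w - fst w) ^ m))
        = (1 - 1 / real m) / L\<^sup>2 / (1 + (t - s) / L / real m) ^ m"
      unfolding diff dim by (rule scale)
    have ind: "indicator ?S w = (indicator {..0} s * indicator {0..} t :: real)"
      using m by (auto simp: w_def z divide_le_0_iff zero_le_divide_iff simp del: of_nat_Suc
          split: split_indicator)
    show "(1 / real m) ^ DIM(real \<times> real) * ?g ((x, y) + (1 / real m) *\<^sub>R z)
      = indicator {..0} (fst z) * indicator {0..} (snd z) *
      ((1 - 1 / real m) / (y - x)\<^sup>2 / (1 + (snd z - fst z) / (y - x) / real m) ^ m *
        \<pi> ((x, y) + (1 / real m) *\<^sub>R z))"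
      unfolding w_def[symmetric] L_def[symmetric] ind
      unfolding z fst_conv snd_conv weight[symmetric] by (simp only: mult_ac)
  qed
  finally show ?thesis .
qed

text \<open>A lower bound free of \<open>m\<close>, for use in domination. With
  \<open>j = m div 4\<close>, Bernoulli gives
  \<open>(1 + u / m) ^ j \<ge> 1 + j * u / m \<ge> 1 + u / 8\<close>, because
  \<open>m \<le> 8 * j\<close> for \<open>m \<ge> 4\<close>; then take fourth powers and use
  \<open>4 * j \<le> m\<close>. The exponent 4 leaves an integrable inverse square for each of two
  variables.\<close>

lemma power_one_plus_divide_ge:
  fixes u :: real
  assumes "0 \<le> u" "m \<ge> 4"
  shows "(1 + u / 8) ^ 4 \<le> (1 + u / real m) ^ m"
proof -
  define j where "j = m div 4"
  have j: "m \<le> 8 * j" "j * 4 \<le> m" using \<open>m \<ge> 4\<close> unfolding j_def by presburger+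
  have "u * real m \<le> u * real (8 * j)"
    using assms j(1) by (intro mult_left_mono) simp_all
  then have "1 + u / 8 \<le> 1 + real j * (u / m)"
    using assms by (simp add: field_simps)
  also have "\<dots> \<le> (1 + u / m) ^ j"
  proof -
    have "0 \<le> u / m" using assms by simp
    then show ?thesis by (intro Bernoulli_inequality) linarith
  qed
  finally have "(1 + u / 8) ^ 4 \<le> ((1 + u / m) ^ j) ^ 4"
    using assms by (intro power_mono) auto
  also have "\<dots> = (1 + u / m) ^ (j * 4)"
    by (simp add: power_mult)
  also have "\<dots> \<le> (1 + u / m) ^ m"
    using assms j by (intro power_increasing) auto
  finally show ?thesis .
qed

section \<open>Dominated convergence off the diagonal\<close>

text \<open>In the rescaled integral the argument of \<open>\<pi>\<close> tends to
  \<open>(x, y)\<close> and the kernel tends to a product of two exponentials. Boundedness of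
  \<open>\<pi>\<close> and the bound on \<open>(1 + u / m) ^ m\<close> give an integrable majorant,
  so the limit passes under the integral.\<close>

lemma f_minmax_tendsto:
  fixes \<pi> :: "real \<times> real \<Rightarrow> real"
  assumes cont: "continuous_on UNIV \<pi>" and bdd: "bounded (range \<pi>)" and "x < y"
  shows "(\<lambda>m. f_minmax \<pi> m x y) \<longlonglongrightarrow> \<pi> (x, y)"
proof -
  define L where "L = y - x"
  have L: "L > 0" using \<open>x < y\<close> by (simp add: L_def)
  have [measurable]: "\<pi> \<in> borel_measurable borel"
    by (rule borel_measurable_continuous_onI[OF cont])
  obtain C where C: "\<And>z. \<bar>\<pi> z\<bar> \<le> C"
    using bdd unfolding bounded_iff by auto
  have "0 \<le> C" using C[of undefined] by linarith
  define G where "G m z = indicator {..0} (fst z) * indicator {0..} (snd z) *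
      ((1 - 1 / real m) / L\<^sup>2 / (1 + (snd z - fst z) / L / real m) ^ m *
        \<pi> ((x, y) + (1 / real m) *\<^sub>R z))" for m and z :: "real \<times> real"
  \<comment> \<open>One factor of the limit kernel. Its integral is \<open>L\<close>, so the product
    of two factors divided by \<open>L\<^sup>2\<close> has mass 1.\<close>
  define e where "e t = exp (- t / L) * indicator {0..} t" for t :: real
  \<comment> \<open>One factor of the majorant, with integral \<open>8 * L\<close>.\<close>
  define d where "d t = 1 / (1 + t / L / 8)\<^sup>2 * indicator {0..} t" for t :: real
  have [measurable]: "e \<in> borel_measurable borel" "d \<in> borel_measurable borel"
    unfolding e_def d_def by measurable
  have "(\<integral>\<^sup>+t. ennreal (e t) \<partial>lborel) = (\<integral>\<^sup>+t. ennreal (exp (- t / L)) * indicator {0..} t \<partial>lborel)"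
    unfolding e_def by (intro nn_integral_cong) (auto split: split_indicator)
  also have "\<dots> = ennreal (0 - - L * exp (- 0 / L))"
  proof (rule nn_integral_FTC_atLeast)
    show "((\<lambda>t. - L * exp (- t / L)) has_real_derivative exp (- t / L)) (at t)" for t
      using L by (auto intro!: derivative_eq_intros)
    show "((\<lambda>t. - L * exp (- t / L)) \<longlongrightarrow> 0) at_top"
      using L by real_asymp
  qed auto
  finally have "(\<integral>\<^sup>+t. ennreal (e t) \<partial>lborel) = ennreal L" by simp
  then have int_e: "has_bochner_integral lborel (\<lambda>z::real \<times> real. e (- fst z) * e (snd z)) (L\<^sup>2)"
    using L by (intro has_bochner_integral_orthant_product) (auto simp: e_def)
  have "(\<integral>\<^sup>+t. ennreal (d t) \<partial>lborel) = (\<integral>\<^sup>+t. ennreal (1 / (1 + t / L / 8)\<^sup>2) * indicator {0..} t \<partial>lborel)"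
    unfolding d_def by (intro nn_integral_cong) (auto split: split_indicator)
  also have "\<dots> = ennreal (0 - - 8 * L / (1 + 0 / L / 8))"
  proof (rule nn_integral_FTC_atLeast)
    show "((\<lambda>t. - 8 * L / (1 + t / L / 8)) has_real_derivative 1 / (1 + t / L / 8)\<^sup>2) (at t)"
      if "0 \<le> t" for t
    proof -
      have "1 + t / L / 8 > 0" using L that by (simp add: add_pos_nonneg)
      then show ?thesis using L
        by (auto intro!: derivative_eq_intros simp: power2_eq_square)
    qed
    show "((\<lambda>t. - 8 * L / (1 + t / L / 8)) \<longlongrightarrow> 0) at_top"
      using L by real_asymp
  qed auto
  finally have "(\<integral>\<^sup>+t. ennreal (d t) \<partial>lborel) = ennreal (8 * L)" by simp
  then have int_d: "has_bochner_integral lborel (\<lambda>z::real \<times> real. d (- fst z) * d (snd z)) ((8 * L)\<^sup>2)"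
    using L by (intro has_bochner_integral_orthant_product) (auto simp: d_def)
  \<comment> \<open>The index is shifted by 4 because the majorant is valid for
    \<open>m \<ge> 4\<close>.\<close>
  have "(\<lambda>i. \<integral>z. G (i + 4) z \<partial>lborel)
      \<longlonglongrightarrow> (\<integral>z. 1 / L\<^sup>2 * \<pi> (x, y) * (e (- fst z) * e (snd z)) \<partial>lborel)"
  proof (rule integral_dominated_convergence)
    show "integrable lborel (\<lambda>z. C / L\<^sup>2 * (d (- fst z) * d (snd z)))"
      using int_d by (intro integrable_mult_right) (auto simp: has_bochner_integral_iff)
    show "AE z in lborel. (\<lambda>i. G (i + 4) z) \<longlonglongrightarrow> 1 / L\<^sup>2 * \<pi> (x, y) * (e (- fst z) * e (snd z))"
    proof (rule AE_I2, rule LIMSEQ_ignore_initial_segment)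
      fix z :: "real \<times> real"
      let ?u = "(snd z - fst z) / L"
      have "(\<lambda>m. (x, y) + (1 / real m) *\<^sub>R z) \<longlonglongrightarrow> (x, y) + 0 *\<^sub>R z"
        by (intro tendsto_intros lim_1_over_n)
      then have "(\<lambda>m. \<pi> ((x, y) + (1 / real m) *\<^sub>R z)) \<longlonglongrightarrow> \<pi> (x, y)"
        using continuous_on_tendsto_compose[OF cont] by fastforce
      then have "(\<lambda>m. G m z) \<longlonglongrightarrow> indicator {..0} (fst z) * indicator {0..} (snd z) *
          ((1 - 0) / L\<^sup>2 / exp ?u * \<pi> (x, y))"
        unfolding G_def using L
        by (intro tendsto_intros lim_1_over_n tendsto_exp_limit_sequentially) auto
      also have "indicator {..0} (fst z) * indicator {0..} (snd z) *
          ((1 - 0) / L\<^sup>2 / exp ?u * \<pi> (x, y)) = 1 / L\<^sup>2 * \<pi> (x, y) * (e (- fst z) * e (snd z))"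
      proof -
        have "exp (- (- fst z) / L) * exp (- snd z / L) = exp (- ?u)"
          by (simp add: diff_divide_distrib flip: exp_add)
        also have "\<dots> = 1 / exp ?u"
          by (simp only: exp_minus inverse_eq_divide)
        finally show ?thesis
          by (simp add: e_def split: split_indicator)
      qed
      finally show "(\<lambda>m. G m z) \<longlonglongrightarrow> 1 / L\<^sup>2 * \<pi> (x, y) * (e (- fst z) * e (snd z))" .
    qed
    show "AE z in lborel. norm (G (i + 4) z) \<le> C / L\<^sup>2 * (d (- fst z) * d (snd z))" for i
    proof (rule AE_I2)
      fix z :: "real \<times> real"
      define m where "m = i + 4"
      show "norm (G (i + 4) z) \<le> C / L\<^sup>2 * (d (- fst z) * d (snd z))"
      proof (cases "fst z \<le> 0 \<and> 0 \<le> snd z")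
        case True
        define \<alpha> where "\<alpha> = - fst z / L"
        define \<beta> where "\<beta> = snd z / L"
        have ab: "0 \<le> \<alpha>" "0 \<le> \<beta>" using True L by (auto simp: \<alpha>_def \<beta>_def divide_nonpos_pos)
        have sum: "(snd z - fst z) / L = \<alpha> + \<beta>" by (simp add: \<alpha>_def \<beta>_def diff_divide_distrib)
        \<comment> \<open>This shares the fourth power evenly: squaring it bounds
          \<open>(1 + (\<alpha> + \<beta>) / 8) ^ 4\<close> from below by a product of one square in
          each variable, which matches the two factors \<open>d\<close>.\<close>
        have "(1 + \<alpha> / 8) * (1 + \<beta> / 8) \<le> (1 + (\<alpha> + \<beta>) / 8)\<^sup>2"
        proof -
          have "0 \<le> (\<alpha> + \<beta>) / 8 + (\<alpha> * \<alpha> + \<beta> * \<beta> + \<alpha> * \<beta>) / 64"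
            using ab by simp
          also have "\<dots> = (1 + (\<alpha> + \<beta>) / 8)\<^sup>2 - (1 + \<alpha> / 8) * (1 + \<beta> / 8)"
            by (simp add: power2_eq_square field_simps)
          finally show ?thesis by simp
        qed
        then have "((1 + \<alpha> / 8) * (1 + \<beta> / 8))\<^sup>2 \<le> ((1 + (\<alpha> + \<beta>) / 8)\<^sup>2)\<^sup>2"
          using ab by (intro power_mono) auto
        also have "\<dots> = (1 + (\<alpha> + \<beta>) / 8) ^ 4"
          by (simp flip: power_mult)
        also have "\<dots> \<le> (1 + (\<alpha> + \<beta>) / m) ^ m"
          using ab by (intro power_one_plus_divide_ge) (auto simp: m_def)
        finally have le: "((1 + \<alpha> / 8) * (1 + \<beta> / 8))\<^sup>2 \<le> (1 + (\<alpha> + \<beta>) / m) ^ m" .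
        have pos: "0 < (1 + (\<alpha> + \<beta>) / m) ^ m" "0 < ((1 + \<alpha> / 8) * (1 + \<beta> / 8))\<^sup>2"
          using ab by (auto intro!: zero_less_power mult_pos_pos add_pos_nonneg)
        have "norm (G m z) = (1 - 1 / real m) / L\<^sup>2 / (1 + (\<alpha> + \<beta>) / m) ^ m *
            \<bar>\<pi> ((x, y) + (1 / real m) *\<^sub>R z)\<bar>"
          using True pos(1) unfolding G_def sum
          by (simp add: abs_mult m_def del: zero_less_power)
        also have "\<dots> \<le> 1 / L\<^sup>2 / ((1 + \<alpha> / 8) * (1 + \<beta> / 8))\<^sup>2 * C"
          using le pos C L by (intro mult_mono frac_le divide_right_mono) (auto simp: m_def)
        also have "\<dots> = C / L\<^sup>2 * (d (- fst z) * d (snd z))"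
          using True by (simp add: d_def \<alpha>_def \<beta>_def power_mult_distrib)
        finally show ?thesis by (simp add: m_def)
      next
        case False
        then show ?thesis using \<open>0 \<le> C\<close>
          by (auto simp: G_def d_def split: split_indicator)
      qed
    qed
    show "(\<lambda>z. 1 / L\<^sup>2 * \<pi> (x, y) * (e (- fst z) * e (snd z))) \<in> borel_measurable lborel"
      by measurable
    show "G (i + 4) \<in> borel_measurable lborel" for i
      unfolding G_def by measurable
  qed
  moreover have "(\<integral>z. 1 / L\<^sup>2 * \<pi> (x, y) * (e (- fst z) * e (snd z)) \<partial>lborel) = \<pi> (x, y)"
    using has_bochner_integral_integral_eq[OF int_e] L by simp
  moreover have "(\<integral>z. G (i + 4) z \<partial>lborel) = f_minmax \<pi> (i + 4) x y" for i
    unfolding G_def L_def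
    by (rule f_minmax_rescaled[symmetric]) (use \<open>x < y\<close> in simp_all)
  ultimately show ?thesis
    by - (rule LIMSEQ_offset[where k = 4], simp only:)
qed

section \<open>Law of the random interval and its pointwise limit\<close>

theorem theorem4:
  fixes \<pi> :: "real \<times> real \<Rightarrow> real"
    and M :: "nat \<Rightarrow> 'w measure"
    and A B :: "nat \<Rightarrow> 'w \<Rightarrow> real"
    and X :: "nat \<Rightarrow> nat \<Rightarrow> 'w \<Rightarrow> real"
    and IX :: "nat \<Rightarrow> 'w \<Rightarrow> real \<times> real"
  assumes pi_nonneg: "\<And>z. 0 \<le> \<pi> z"
    and pi_bounded: "bounded (range \<pi>)"
    and pi_continuous: "continuous_on UNIV \<pi>"
    and pi_zero: "\<And>a b. a > b \<Longrightarrow> \<pi> (a, b) = 0"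
    and prob: "\<And>m. m \<ge> 2 \<Longrightarrow> prob_space (M m)"
    and AB_density: "\<And>m. m \<ge> 2 \<Longrightarrow>
          distributed (M m) lborel (\<lambda>\<omega>. (A m \<omega>, B m \<omega>)) (\<lambda>z. ennreal (\<pi> z))"
    and X_cond_iid: "\<And>m. m \<ge> 2 \<Longrightarrow> cond_iid_uniform (M m) m (A m) (B m) (X m)"
    and IX: "\<And>m \<omega>. m \<ge> 2 \<Longrightarrow> \<omega> \<in> space (M m) \<Longrightarrow>
          IX m \<omega> = order_interval 1 m (map (\<lambda>k. X m k \<omega>) [1..<Suc m])"
  shows "(\<forall>m\<ge>2. distributed (M m) lborel (IX m)
            (\<lambda>(x, y). ennreal (if x \<le> y then f_minmax \<pi> m x y else 0))) \<and>
         (\<forall>x y. x \<le> y \<longrightarrow> (\<lambda>m. f_minmax \<pi> m x y) \<longlonglongrightarrow> \<pi> (x, y))"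
proof (intro conjI allI impI)
  note diag = continuous_zero_diagonal[OF pi_continuous pi_zero]
  have zero: "\<pi> (a, b) = 0" if "a \<ge> b" for a b
    using that pi_zero diag by (cases "a = b") auto
  fix m :: nat assume m: "m \<ge> 2"
  let ?f = "\<lambda>(x, y). ennreal (if x \<le> y then f_minmax \<pi> m x y else 0)"
  let ?Y = "\<lambda>\<omega>. (Min ((\<lambda>k. X m k \<omega>) ` {1..m}), Max ((\<lambda>k. X m k \<omega>) ` {1..m}))"
  have Y: "distributed (M m) lborel ?Y ?f"
    by (rule distributed_minmax[OF prob[OF m] m pi_nonneg zero AB_density[OF m] X_cond_iid[OF m]])
  \<comment> \<open>Equality on the sample space is enough, since neither measurability nor the
    image measure depends on values outside it.\<close>
  have eq: "IX m \<omega> = ?Y \<omega>" if "\<omega> \<in> space (M m)" for \<omega>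
  proof -
    define xs where "xs = map (\<lambda>k. X m k \<omega>) [1..<Suc m]"
    have "length xs = m" by (simp add: xs_def)
    moreover from this have "xs \<noteq> []" using m by auto
    moreover have "set xs = (\<lambda>k. X m k \<omega>) ` {1..m}"
      by (simp only: xs_def set_map set_upt atLeastLessThanSuc_atLeastAtMost)
    ultimately show ?thesis
      using IX[OF m that, folded xs_def] order_interval_1_length[of xs] by simp
  qed
  have "distr (M m) lborel (IX m) = distr (M m) lborel ?Y"
    by (rule distr_cong) (use eq in auto)
  moreover have "IX m \<in> M m \<rightarrow>\<^sub>M lborel \<longleftrightarrow> ?Y \<in> M m \<rightarrow>\<^sub>M lborel"
    by (rule measurable_cong) (rule eq)
  ultimately show "distributed (M m) lborel (IX m) ?f"
    using Y unfolding distributed_def by (simp only:)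
next
  fix x y :: real assume "x \<le> y"
  show "(\<lambda>m. f_minmax \<pi> m x y) \<longlonglongrightarrow> \<pi> (x, y)"
  proof (cases "x < y")
    case True
    then show ?thesis by (rule f_minmax_tendsto[OF pi_continuous pi_bounded])
  next
    case False
    with \<open>x \<le> y\<close> have "x = y" by simp
    moreover have "\<pi> (x, x) = 0"
      by (rule continuous_zero_diagonal[OF pi_continuous pi_zero])
    \<comment> \<open>For \<open>m \<ge> 3\<close> the factor \<open>(y - x) ^ (m - 2)\<close> is 0
      on the diagonal; at \<open>m = 2\<close> it would be \<open>0 ^ 0 = 1\<close>, so the sequence
      is only eventually 0.\<close>
    moreover have "f_minmax \<pi> m x x = 0" if "m \<ge> 3" for m
      using that by (simp add: f_minmax_def set_lebesgue_integral_def case_prod_beta zero_power)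
    ultimately show ?thesis
      by (auto intro!: tendsto_eventually eventually_sequentiallyI[of 3])
  qed
qed

end
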